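(* Let $A$ be an irreducible $n\times n$ matrix with entries in $\{0,1\}$, and let $X_A$ be the associated shift of finite type over the alphabet $\mathcal A=\{0,\ldots,n-1\}$. Then there exists a primitive random substitution $\vartheta\colon \mathcal A\to\mathcal S(\mathcal A^+)$ with associated RS-subshift $X_\vartheta$ such that $X_\vartheta = X_A$.
   Context: A non-negative integer square matrix $A$ is irreducible if for all $i,j$ there is an integer $k\ge 1$ with $(A^k)_{ij}\ge 1$. For an $n\times n$ matrix $A$ with entries in $\{0,1\}$ (rows and columns indexed by $\{0,\dots,n-1\}$), the associated shift of finite type is $X_A=\{x\in\{0,\ldots,n-1\}^{\mathbb Z} : A_{x_i,x_{i+1}}=1 \text{ for all } i\in\mathbb Z\}$. For a finite alphabet $\mathcal A$, $\mathcal A^+$ is the set of non-empty finite words over $\mathcal A$, and $\mathcal S(\mathcal A^+)$ is the set of all non-empty finite subsets of $\mathcal A^+$. A random substitution on $\mathcal A$ is a map $\vartheta\colon\mathcal A\to\mathcal S(\mathcal A^+)$ (no probabilities are recorded). It extends to words by $\vartheta(a_1\cdots a_m)=\{u_1\cdots u_m : u_i\in\vartheta(a_i)\}$ and to finite non-empty sets of words by $\vartheta(B)=\bigcup_{u\in B}\vartheta(u)$; powers $\vartheta^k$ are defined by iterated composition, with $\vartheta^0=\mathrm{id}$ (so $\vartheta^0(a)=\{a\}$). The language $\mathcal L_\vartheta$ is the set of all words $u$ that are (contiguous) subwords of some element of $\vartheta^k(a)$ for some $k\ge0$ and $a\in\mathcal A$. The RS-subshift is $X_\vartheta=\{w\in\mathcal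 A^{\mathbb Z} : \text{every finite subword of } w \text{ lies in } \mathcal L_\vartheta\}$. The random substitution $\vartheta$ is primitive if there is $k\in\mathbb N$ such that for all $a,b\in\mathcal A$ the letter $a$ occurs in some element of $\vartheta^k(b)$. *)

theory Defs
  imports "Jordan_Normal_Form.Matrix" "HOL-Library.Sublist"
begin

section \<open>Irreducible matrices and shifts of finite type\<close>

definition irreducible_mat :: "nat mat \<Rightarrow> bool" where
  "irreducible_mat A \<longleftrightarrow> square_mat A \<and>
     (\<forall>i < dim_row A. \<forall>j < dim_row A. \<exists>k \<ge> 1. (A ^\<^sub>m k) $$ (i, j) \<ge> 1)"

definition sft :: "nat mat \<Rightarrow> (int \<Rightarrow> nat) set" where
  "sft A = {x. range x \<subseteq> {..<dim_row A} \<and> (\<forall>i. A $$ (x i, x (i + 1)) = 1)}"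

section \<open>Random substitutions\<close>

text \<open>
  The alphabet is an explicit set \<open>\<A>\<close>.  A random substitution on \<open>\<A>\<close> is a function on the whole
  letter type; its values outside \<open>\<A>\<close> are unconstrained and never matter, since words over \<open>\<A>\<close>
  are only ever mapped to words over \<open>\<A>\<close>.
\<close>

definition random_substitution :: "'a set \<Rightarrow> ('a \<Rightarrow> 'a list set) \<Rightarrow> bool" where
  "random_substitution \<A> \<theta> \<longleftrightarrow> finite \<A> \<and>
     (\<forall>a \<in> \<A>. finite (\<theta> a) \<and> \<theta> a \<noteq> {} \<and> \<theta> a \<subseteq> lists \<A> - {[]})"

text \<open>\<^const>\<open>listset\<close> forms all lists \<open>[u\<^sub>1, \<dots>, u\<^sub>m]\<close> with \<open>u\<^sub>i \<in> \<theta> a\<^sub>i\<close>.\<close>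

definition rs_word :: "('a \<Rightarrow> 'a list set) \<Rightarrow> 'a list \<Rightarrow> 'a list set" where
  "rs_word \<theta> w = concat ` listset (map \<theta> w)"

definition rs_words :: "('a \<Rightarrow> 'a list set) \<Rightarrow> 'a list set \<Rightarrow> 'a list set" where
  "rs_words \<theta> B = (\<Union>u \<in> B. rs_word \<theta> u)"

definition rs_power :: "('a \<Rightarrow> 'a list set) \<Rightarrow> nat \<Rightarrow> 'a \<Rightarrow> 'a list set" where
  "rs_power \<theta> k a = (rs_words \<theta> ^^ k) {[a]}"

definition rs_language :: "'a set \<Rightarrow> ('a \<Rightarrow> 'a list set) \<Rightarrow> 'a list set" where
  "rs_language \<A> \<theta> = {u. \<exists>k. \<exists>a \<in> \<A>. \<exists>v \<in> rs_power \<theta> k a. sublist u v}"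

text \<open>
  The finite subwords of a bi-infinite word \<open>w\<close> are the \<open>w i w (i + 1) \<dots> w j\<close>; for \<open>j < i\<close> this is
  the empty word.
\<close>

definition rs_subshift :: "'a set \<Rightarrow> ('a \<Rightarrow> 'a list set) \<Rightarrow> (int \<Rightarrow> 'a) set" where
  "rs_subshift \<A> \<theta> =
     {w. range w \<subseteq> \<A> \<and> (\<forall>i j. map w [i..j] \<in> rs_language \<A> \<theta>)}"

text \<open>
  Excluding \<open>k = 0\<close> only affects alphabets with at most one letter, where primitivity of a random
  substitution holds either way.
\<close>

definition rs_primitive :: "'a set \<Rightarrow> ('a \<Rightarrow> 'a list set) \<Rightarrow> bool" where
  "rs_primitive \<A> \<theta> \<longleftrightarrow>
     (\<exists>k \<ge> 1. \<forall>a \<in> \<A>. \<forall>b \<in> \<A>. \<exists>u \<in> rs_power \<theta> k b. a \<in> set u)"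

end

theory Submission
  imports Defs
begin

text \<open>
  Read \<open>A\<close> as the adjacency matrix of a directed graph on \<open>{..<n}\<close>; the legal words of the
  shift of finite type are the walks of this graph, and irreducibility says that any two vertices
  are joined by a walk.  Let \<open>\<theta>\<close> send a vertex \<open>a\<close> to the set of closed walks at \<open>a\<close> with at most
  \<open>n + 1\<close> letters, among them the one-letter word \<open>a\<close>.

  Every image of \<open>a\<close> begins and ends with \<open>a\<close>, so whenever two letters may follow each other, so
  may any of their images.  Hence \<open>\<theta>\<close> maps walks to walks, and the language contains only walks
  (\<open>walk_rs_word\<close>).  Conversely, every closed walk at \<open>a\<close> lies in some \<open>\<theta>\<^sup>k(a)\<close>
  (\<open>closed_walk_in_rs_power\<close>): a closed walk of more than one letter repeats a vertex, so it
  contains a cycle \<open>b c b\<close> whose letters in \<open>b c\<close> are distinct.  Such a cycle has at most \<open>n + 1\<close>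
  letters and is an image of \<open>b\<close>; since every other letter is an image of itself, the walk is an
  image of the shorter closed walk in which the cycle is contracted to \<open>b\<close>.

  By connectedness every walk begins some closed walk, so the language consists of exactly the
  walks, which gives the equality of the subshifts.  Primitivity follows too, because some closed
  walk at \<open>a\<close> visits \<open>b\<close>, and \<open>\<theta>\<^sup>k(a)\<close> grows with \<open>k\<close>.
\<close>

section \<open>Images of words under a random substitution\<close>

lemma rs_word_Nil [simp]: "rs_word \<theta> [] = {[]}"
  by (simp add: rs_word_def)

lemma rs_word_Cons: "rs_word \<theta> (a # w) = {u @ v |u v. u \<in> \<theta> a \<and> v \<in> rs_word \<theta> w}"
proof (intro equalityI subsetI)
  fix x assume "x \<in> {u @ v |u v. u \<in> \<theta> a \<and> v \<in> rs_word \<theta> w}"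
  then obtain u vs where "x = concat (u # vs)" "u \<in> \<theta> a" "vs \<in> listset (map \<theta> w)"
    by (auto simp: rs_word_def)
  moreover from this have "u # vs \<in> listset (map \<theta> (a # w))" by (simp add: set_Cons_def)
  ultimately show "x \<in> rs_word \<theta> (a # w)" unfolding rs_word_def by blast
next
  fix x assume "x \<in> rs_word \<theta> (a # w)"
  then obtain u vs where "x = u @ concat vs" "u \<in> \<theta> a" "vs \<in> listset (map \<theta> w)"
    by (auto simp: rs_word_def set_Cons_def)
  then show "x \<in> {u @ v |u v. u \<in> \<theta> a \<and> v \<in> rs_word \<theta> w}" unfolding rs_word_def by blast
qed

lemma append_in_rs_word:
  assumes "u \<in> rs_word \<theta> x" and "v \<in> rs_word \<theta> y"
  shows "u @ v \<in> rs_word \<theta> (x @ y)"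
  using assms(1)
proof (induction x arbitrary: u)
  case Nil
  then show ?case using assms(2) by simp
next
  case (Cons a x)
  then obtain u1 u2 where "u = u1 @ u2" "u1 \<in> \<theta> a" "u2 \<in> rs_word \<theta> x"
    by (auto simp: rs_word_Cons)
  moreover from this have "u1 @ (u2 @ v) \<in> rs_word \<theta> (a # (x @ y))"
    using Cons.IH[of u2] unfolding rs_word_Cons by blast
  ultimately show ?case by simp
qed

lemma self_in_rs_word:
  assumes "\<forall>a \<in> set w. [a] \<in> \<theta> a"
  shows "w \<in> rs_word \<theta> w"
  using assms
proof (induction w)
  case (Cons a w)
  then have "[a] \<in> \<theta> a" and "w \<in> rs_word \<theta> w" by simp_all
  then have "[a] @ w \<in> rs_word \<theta> (a # w)" unfolding rs_word_Cons by blast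
  then show ?case by simp
qed simp

lemma rs_power_0 [simp]: "rs_power \<theta> 0 a = {[a]}"
  by (simp add: rs_power_def)

lemma rs_power_Suc: "rs_power \<theta> (Suc k) a = (\<Union>u \<in> rs_power \<theta> k a. rs_word \<theta> u)"
  by (simp add: rs_power_def rs_words_def)

section \<open>Walks\<close>

definition walk :: "'a set \<Rightarrow> ('a \<Rightarrow> 'a \<Rightarrow> bool) \<Rightarrow> 'a \<Rightarrow> 'a list \<Rightarrow> 'a \<Rightarrow> bool" where
  "walk V E a u b \<longleftrightarrow>
     u \<noteq> [] \<and> hd u = a \<and> last u = b \<and> set u \<subseteq> V \<and> successively E u"

lemma walk_singleton [simp]: "walk V E a [c] b \<longleftrightarrow> c = a \<and> c = b \<and> c \<in> V"
  by (auto simp: walk_def)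

lemma walk_split:
  "walk V E a (p @ b # q) c \<longleftrightarrow> walk V E a (p @ [b]) b \<and> walk V E b (b # q) c"
  using successively_append_iff[of E p "b # q"] successively_append_iff[of E p "[b]"]
  by (auto simp: walk_def hd_append split: if_splits)

lemma walk_append_edge:
  assumes "walk V E a u b" and "E b c" and "walk V E c v d"
  shows "walk V E a (u @ v) d"
  using assms by (auto simp: walk_def successively_append_iff)

lemma walk_join:
  assumes "walk V E a u b" and "walk V E b v c"
  shows "\<exists>w. walk V E a (u @ w) c"
proof -
  obtain p where u: "u = p @ [b]"
    using assms(1) by (metis append_butlast_last_id walk_def)
  obtain w where v: "v = b # w"
    using assms(2) by (metis list.collapse walk_def)
  have "walk V E a (p @ b # w) c"
    using assms unfolding walk_split[of V E a p b w c] u v by simp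
  then show ?thesis unfolding u by auto
qed

lemma rtranclp_imp_walk:
  assumes "E\<^sup>*\<^sup>* a b" and "a \<in> V" and "\<And>x y. E x y \<Longrightarrow> y \<in> V"
  shows "\<exists>u. walk V E a u b"
  using assms(1)
proof (induction rule: rtranclp_induct)
  case base
  show ?case using assms(2) by (intro exI[of _ "[a]"]) simp
next
  case (step b c)
  then obtain u where "walk V E a u b" by blast
  moreover have "walk V E c [c] c" using step assms(3) by simp
  ultimately show ?case using step walk_append_edge by metis
qed

text \<open>Let \<open>b\<close> stand at the last position whose letter occurs again: the letters after it are then
  pairwise distinct, and so is the segment up to its return.\<close>

lemma not_distinct_decomp_simple:
  assumes "\<not> distinct u"
  shows "\<exists>p b c q. u = p @ b # c @ b # q \<and> distinct (b # c)"
  using assms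
proof (induction u)
  case (Cons x u)
  show ?case
  proof (cases "distinct u")
    case True
    with Cons.prems obtain c q where "u = c @ x # q" by (auto dest: split_list)
    with True show ?thesis
      by (intro exI[of _ "[]"] exI[of _ x] exI[of _ c] exI[of _ q]) auto
  next
    case False
    then obtain p b c q where "u = p @ b # c @ b # q" "distinct (b # c)"
      using Cons.IH by blast
    then show ?thesis by (intro exI[of _ "x # p"]) auto
  qed
qed simp

section \<open>The substitution by short closed walks\<close>

definition short_closed_walks :: "'a set \<Rightarrow> ('a \<Rightarrow> 'a \<Rightarrow> bool) \<Rightarrow> 'a \<Rightarrow> 'a list set" where
  "short_closed_walks V E a = {u. walk V E a u a \<and> length u \<le> card V + 1}"

lemma singleton_in_short_closed_walks: "a \<in> V \<Longrightarrow> [a] \<in> short_closed_walks V E a"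
  by (simp add: short_closed_walks_def)

lemma random_substitution_short_closed_walks:
  assumes "finite V"
  shows "random_substitution V (short_closed_walks V E)"
proof -
  have "finite (short_closed_walks V E a)" for a
    by (rule finite_subset[OF _ finite_lists_length_le[OF assms, of "card V + 1"]])
       (auto simp: short_closed_walks_def walk_def)
  moreover have "short_closed_walks V E a \<noteq> {}" if "a \<in> V" for a
    using singleton_in_short_closed_walks[OF that] by blast
  moreover have "short_closed_walks V E a \<subseteq> lists V - {[]}" for a
    by (auto simp: short_closed_walks_def walk_def)
  ultimately show ?thesis using assms by (simp add: random_substitution_def)
qed

text \<open>An edge from \<open>a\<close> to \<open>b\<close> joins the last letter of any image of \<open>a\<close> to the first letter of any
  image of \<open>b\<close>, so the images of the letters of a walk fit together.\<close>

lemma walk_rs_word: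
  assumes "walk V E a w b" and "u \<in> rs_word (short_closed_walks V E) w"
  shows "walk V E a u b"
  using assms
proof (induction w arbitrary: a u)
  case Nil
  then show ?case by (simp add: walk_def)
next
  case (Cons x w)
  have "x = a" using Cons.prems(1) by (simp add: walk_def)
  then obtain u1 u2 where u: "u = u1 @ u2" and u1: "walk V E a u1 a"
    and u2: "u2 \<in> rs_word (short_closed_walks V E) w"
    using Cons.prems(2) unfolding rs_word_Cons short_closed_walks_def by blast
  show ?case
  proof (cases "w = []")
    case True
    then show ?thesis using u u1 u2 Cons.prems(1) by auto
  next
    case False
    with Cons.prems(1) have "E a (hd w)" "walk V E (hd w) w b"
      by (auto simp: walk_def successively_Cons)
    then show ?thesis using Cons.IH u u1 u2 walk_append_edge by metis
  qed
qed

lemma walk_rs_power: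
  assumes "a \<in> V" and "u \<in> rs_power (short_closed_walks V E) k a"
  shows "walk V E a u a"
  using assms(2)
  by (induction k arbitrary: u) (use assms(1) in \<open>auto simp: rs_power_Suc intro: walk_rs_word\<close>)

lemma rs_power_mono:
  assumes "a \<in> V" and "k \<le> l"
  shows "rs_power (short_closed_walks V E) k a \<subseteq> rs_power (short_closed_walks V E) l a"
  using assms(2)
proof (induction l rule: dec_induct)
  case (step l)
  have "u \<in> rs_word (short_closed_walks V E) u"
    if "u \<in> rs_power (short_closed_walks V E) l a" for u
    using walk_rs_power[OF assms(1) that]
    by (auto simp: walk_def intro!: self_in_rs_word singleton_in_short_closed_walks)
  with step show ?case by (auto simp: rs_power_Suc)
qed simp

text \<open>Undoing substitutions: a closed walk of at least two letters contains a cycle short enough to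
  be an image of its base point, and contracting it leaves a shorter closed walk.\<close>

lemma closed_walk_in_rs_power:
  assumes "finite V" and "walk V E a u a"
  shows "\<exists>k. u \<in> rs_power (short_closed_walks V E) k a"
  using assms(2)
proof (induction u rule: length_induct)
  case (1 u)
  let ?\<theta> = "short_closed_walks V E"
  show ?case
  proof (cases "distinct u")
    case True
    \<comment> \<open>First and last letter agree, so without repetition they are the same position.\<close>
    have "u = [a]"
      using 1(2) True unfolding walk_def
      by (metis distinct.simps(2) last.simps last_in_set list.collapse)
    then have "u \<in> rs_power ?\<theta> 0 a" by simp
    then show ?thesis by blast
  next
    case False
    then obtain p b c q where u: "u = p @ b # c @ b # q" and bc: "distinct (b # c)"
      using not_distinct_decomp_simple by blast
    have pre: "walk V E a (p @ [b]) b" and "walk V E b ((b # c) @ b # q) a"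
      using 1(2) walk_split[of V E a p b "c @ b # q" a] unfolding u by auto
    then have cyc: "walk V E b (b # c @ [b]) b" and post: "walk V E b (b # q) a"
      using walk_split[of V E b "b # c" b q a] by auto
    have contracted: "walk V E a (p @ b # q) a"
      using pre post walk_split[of V E a p b q a] by blast
    moreover have "length (p @ b # q) < length u" by (simp add: u)
    ultimately obtain k where k: "p @ b # q \<in> rs_power ?\<theta> k a"
      using 1(1) by blast
    have "set (b # c) \<subseteq> V" using cyc by (auto simp: walk_def)
    then have "length (b # c) \<le> card V"
      using bc card_mono[OF assms(1)] distinct_card by metis
    then have "b # c @ [b] \<in> ?\<theta> b" using cyc by (simp add: short_closed_walks_def)
    then have "b # c @ [b] \<in> rs_word ?\<theta> [b]" by (simp add: rs_word_Cons)
    moreover have "p \<in> rs_word ?\<theta> p" "q \<in> rs_word ?\<theta> q"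
      using contracted
      by (auto simp: walk_def intro!: self_in_rs_word singleton_in_short_closed_walks)
    ultimately have "p @ (b # c @ [b]) @ q \<in> rs_word ?\<theta> (p @ [b] @ q)"
      by (intro append_in_rs_word)
    then have "u \<in> rs_power ?\<theta> (Suc k) a"
      using k unfolding rs_power_Suc u by (intro UN_I) simp_all
    then show ?thesis by blast
  qed
qed

section \<open>Strongly connected graphs\<close>

lemma rs_primitive_short_closed_walks:
  assumes "finite V" and connected: "\<And>a b. a \<in> V \<Longrightarrow> b \<in> V \<Longrightarrow> \<exists>u. walk V E a u b"
  shows "rs_primitive V (short_closed_walks V E)"
proof -
  let ?\<theta> = "short_closed_walks V E"
  have "\<exists>k. \<exists>u \<in> rs_power ?\<theta> k b. a \<in> set u" if ab: "a \<in> V" "b \<in> V" for a b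
  proof -
    obtain u v where u: "walk V E b u a" and v: "walk V E a v b"
      using connected[OF ab] connected[OF ab(2,1)] by blast
    obtain w where "walk V E b (u @ w) b" using walk_join[OF u v] by blast
    moreover have "a \<in> set (u @ w)" using u by (auto simp: walk_def)
    ultimately show ?thesis using closed_walk_in_rs_power[OF assms(1)] by blast
  qed
  then obtain K where
    K: "\<And>a b. a \<in> V \<Longrightarrow> b \<in> V \<Longrightarrow> \<exists>u \<in> rs_power ?\<theta> (K a b) b. a \<in> set u"
    by metis
  \<comment> \<open>A bound on all \<open>K a b\<close> that makes sense for an empty alphabet too; \<open>Suc\<close> makes it positive.\<close>
  define m where "m = Suc (\<Sum>(a, b) \<in> V \<times> V. K a b)"
  have "K a b \<le> m" if "a \<in> V" "b \<in> V" for a b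
    using member_le_sum[of "(a, b)" "V \<times> V" "\<lambda>(a, b). K a b"] that assms(1)
    by (simp add: m_def)
  then have "\<forall>a \<in> V. \<forall>b \<in> V. \<exists>u \<in> rs_power ?\<theta> m b. a \<in> set u"
    using K rs_power_mono[of _ V _ m E] by blast
  moreover have "m \<ge> 1" by (simp add: m_def)
  ultimately show ?thesis unfolding rs_primitive_def by blast
qed

lemma rs_language_short_closed_walks:
  assumes "finite V" and "V \<noteq> {}"
    and connected: "\<And>a b. a \<in> V \<Longrightarrow> b \<in> V \<Longrightarrow> \<exists>u. walk V E a u b"
  shows "rs_language V (short_closed_walks V E) = {u. set u \<subseteq> V \<and> successively E u}"
proof (intro equalityI subsetI)
  fix u assume "u \<in> rs_language V (short_closed_walks V E)"
  then obtain k a p q where "a \<in> V" "p @ u @ q \<in> rs_power (short_closed_walks V E) k a"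
    unfolding rs_language_def sublist_def by blast
  then have "walk V E a (p @ u @ q) a" by (rule walk_rs_power)
  then show "u \<in> {u. set u \<subseteq> V \<and> successively E u}"
    by (auto simp: walk_def successively_append_iff)
next
  fix u assume "u \<in> {u. set u \<subseteq> V \<and> successively E u}"
  then have u: "set u \<subseteq> V" "successively E u" by auto
  obtain a w where a: "a \<in> V" and w: "walk V E a (u @ w) a"
  proof (cases "u = []")
    case True
    obtain a where "a \<in> V" using assms(2) by blast
    then show ?thesis using that[of a "[a]"] True by simp
  next
    case False
    then have "hd u \<in> V" "last u \<in> V" and fwd: "walk V E (hd u) u (last u)"
      using u by (auto simp: walk_def)
    then obtain v where "walk V E (last u) v (hd u)" using connected by blast
    then obtain w where "walk V E (hd u) (u @ w) (hd u)" using walk_join[OF fwd] by blast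
    with \<open>hd u \<in> V\<close> show ?thesis by (rule that)
  qed
  obtain k where "u @ w \<in> rs_power (short_closed_walks V E) k a"
    using closed_walk_in_rs_power[OF assms(1) w] by blast
  then show "u \<in> rs_language V (short_closed_walks V E)"
    using a by (auto simp: rs_language_def)
qed

lemma rs_subshift_short_closed_walks:
  assumes "finite V"
    and connected: "\<And>a b. a \<in> V \<Longrightarrow> b \<in> V \<Longrightarrow> \<exists>u. walk V E a u b"
  shows "rs_subshift V (short_closed_walks V E) =
    {x. range x \<subseteq> V \<and> (\<forall>i. E (x i) (x (i + 1)))}"
proof (cases "V = {}")
  case True
  then show ?thesis by (auto simp: rs_subshift_def)
next
  case False
  have "rs_language V (short_closed_walks V E) = {u. set u \<subseteq> V \<and> successively E u}"
    by (rule rs_language_short_closed_walks) (use assms False in blast)+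
  then have lang: "map x [i..j] \<in> rs_language V (short_closed_walks V E) \<longleftrightarrow>
      successively E (map x [i..j])"
    if "range x \<subseteq> V" for x :: "int \<Rightarrow> 'a" and i j
    using that by (auto simp: image_subset_iff)
  have edge: "E (x i) (x (i + 1))" if "\<forall>i j. successively E (map x [i..j])"
    for x :: "int \<Rightarrow> 'a" and i
  proof -
    have "successively E (map x [i..i + 1])" using that by blast
    then show ?thesis by (simp add: upto_rec1)
  qed
  have "successively E (map x [i..j])" if "\<forall>i. E (x i) (x (i + 1))"
    for x :: "int \<Rightarrow> 'a" and i j
  proof -
    have "E (x (i + int k)) (x (i + int (Suc k)))" for k
      using spec[OF that, of "i + int k"] by (simp add: ac_simps)
    then show ?thesis by (auto simp: successively_conv_nth)
  qed
  with lang edge have "(\<forall>i j. map x [i..j] \<in> rs_language V (short_closed_walks V E)) \<longleftrightarrow>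
      (\<forall>i. E (x i) (x (i + 1)))" if "range x \<subseteq> V" for x :: "int \<Rightarrow> 'a"
    using that by blast
  then show ?thesis unfolding rs_subshift_def by blast
qed

section \<open>Irreducible matrices\<close>

lemma pow_mat_pos_imp_rtranclp:
  fixes A :: "nat mat"
  assumes "A \<in> carrier_mat n n" and "i < n" and "j < n" and "(A ^\<^sub>m k) $$ (i, j) > 0"
  shows "(\<lambda>a b. a < n \<and> b < n \<and> A $$ (a, b) > 0)\<^sup>*\<^sup>* i j"
  using assms(3,4)
proof (induction k arbitrary: j)
  case 0
  then show ?case using assms(1,2) by (auto split: if_splits)
next
  case (Suc k)
  have "(A ^\<^sub>m Suc k) $$ (i, j) = (\<Sum>l < n. (A ^\<^sub>m k) $$ (i, l) * A $$ (l, j))"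
    using assms(1,2) Suc.prems(1) pow_carrier_mat[OF assms(1), of k]
    by (simp add: scalar_prod_def lessThan_atLeast0)
  with Suc.prems(2) obtain l where "l < n" "(A ^\<^sub>m k) $$ (i, l) * A $$ (l, j) > 0"
    by (metis (no_types, lifting) bot_nat_0.not_eq_extremum lessThan_iff sum.neutral)
  with Suc show ?case by (auto intro: rtranclp.rtrancl_into_rtrancl)
qed

theorem theorem22:
  fixes A :: "nat mat" and n :: nat
  assumes "A \<in> carrier_mat n n"
    and "elements_mat A \<subseteq> {0, 1}"
    and "irreducible_mat A"
  shows "\<exists>\<theta>. random_substitution {..<n} \<theta> \<and> rs_primitive {..<n} \<theta> \<and>
           rs_subshift {..<n} \<theta> = sft A"
proof -
  define E where "E = (\<lambda>a b. a < n \<and> b < n \<and> A $$ (a, b) > 0)"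
  let ?\<theta> = "short_closed_walks {..<n} E"
  have dim: "dim_row A = n" "dim_col A = n" using assms(1) by auto
  have edge_iff: "E a b \<longleftrightarrow> A $$ (a, b) = 1" if "a < n" "b < n" for a b
  proof -
    have "A $$ (a, b) \<in> {0, 1}"
      using assms(2) elements_matI[OF assms(1) that refl] by blast
    then show ?thesis using that by (auto simp: E_def)
  qed
  have connected: "\<exists>u. walk {..<n} E a u b" if ab: "a \<in> {..<n}" "b \<in> {..<n}" for a b
  proof -
    obtain k where "(A ^\<^sub>m k) $$ (a, b) \<ge> 1"
      using assms(3) ab unfolding irreducible_mat_def dim lessThan_iff by blast
    then have "E\<^sup>*\<^sup>* a b"
      using pow_mat_pos_imp_rtranclp[OF assms(1), of a b k] ab unfolding E_def by auto
    then show ?thesis by (rule rtranclp_imp_walk) (use ab in \<open>auto simp: E_def\<close>)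
  qed
  have "rs_subshift {..<n} ?\<theta> = {x. range x \<subseteq> {..<n} \<and> (\<forall>i. E (x i) (x (i + 1)))}"
    by (rule rs_subshift_short_closed_walks) (use connected in auto)
  also have "\<dots> = sft A"
    unfolding sft_def dim using edge_iff by (auto simp: image_subset_iff)
  finally show ?thesis
    using random_substitution_short_closed_walks[of "{..<n}" E]
      rs_primitive_short_closed_walks[of "{..<n}" E] connected by blast
qed

end
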